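(* There is an absolute constant $c>0$ such that $D_n \ge c\, n^{2/3}$ for every positive integer $n$; that is, $D_n=\Omega(n^{2/3})$, where $D_n$ is the geometric domination number of the $n\times n$ grid.
   Context: The $n\times n$ grid is $\{1,\dots,n\}\times\{1,\dots,n\}$. Three points are collinear if they lie on a common straight line in the plane. A point $p$ of the grid is dominated by a subset $S$ of the grid if $p\in S$ or there exist two distinct points $x,y\in S$ such that $x,y,p$ are collinear. A subset $S$ of the grid is a (geometric) dominating set if every point of the grid is dominated by $S$. The (geometric) domination number $D_n$ is the smallest size of a dominating set of the $n\times n$ grid. *)

theory Defs
  imports "HOL-Analysis.Analysis"
begin

definition grid :: "nat \<Rightarrow> (real \<times> real) set" where
  "grid n = {(real i, real j) | i j. i \<in> {1..n} \<and> j \<in> {1..n}}"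

definition dominated :: "(real \<times> real) set \<Rightarrow> real \<times> real \<Rightarrow> bool" where
  "dominated S p \<longleftrightarrow> p \<in> S \<or> (\<exists>x\<in>S. \<exists>y\<in>S. x \<noteq> y \<and> collinear {x, y, p})"

definition dominating_set :: "nat \<Rightarrow> (real \<times> real) set \<Rightarrow> bool" where
  "dominating_set n S \<longleftrightarrow> S \<subseteq> grid n \<and> (\<forall>p\<in>grid n. dominated S p)"

definition domination_number :: "nat \<Rightarrow> nat" where
  "domination_number n = (LEAST k. \<exists>S. dominating_set n S \<and> card S = k)"

text \<open>The minimum is attained, because the whole grid is a dominating set; and since
  the grid is finite, \<^const>\<open>card\<close> is the true size of every candidate.\<close>

lemma finite_grid: "finite (grid n)"
proof -
  have "grid n = (\<lambda>(i, j). (real i, real j)) ` ({1..n} \<times> {1..n})"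
    by (auto simp: grid_def)
  then show ?thesis by simp
qed

lemma dominating_set_grid: "dominating_set n (grid n)"
  by (simp add: dominating_set_def dominated_def)

lemma domination_number_attained:
  "\<exists>S. dominating_set n S \<and> card S = domination_number n"
  unfolding domination_number_def
  by (rule LeastI_ex) (use dominating_set_grid in blast)

end

theory Submission
  imports Defs
begin

text \<open>Through a fixed point \<open>x\<close> of a dominating set of size \<open>k\<close> pass at most \<open>k\<close> lines spanned by the
  set, each with its own primitive direction. A line whose primitive direction has maximum norm \<open>m\<close>
  contains \<open>O(n / m)\<close> grid points, and only \<open>O(m)\<close> directions have norm \<open>m\<close>. The directions of norm
  at most \<open>\<surd>k\<close> therefore account for \<open>O(n \<surd>k)\<close> grid points, and so do the at most \<open>k\<close> remaining
  lines. Summing over \<open>x\<close> gives \<open>n\<^sup>2 = O(k n \<surd>k)\<close>.\<close>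

section \<open>Multiples of short directions\<close>

definition multipliers :: "nat \<Rightarrow> nat \<Rightarrow> int set" where
  "multipliers n m = {- int (n div m)..int (n div m)} - {0}"

lemma finite_multipliers [simp]: "finite (multipliers n m)"
  by (simp add: multipliers_def)

lemma card_multipliers: "card (multipliers n m) = 2 * (n div m)"
  by (simp add: multipliers_def card_Diff_singleton)

lemma in_multipliersI:
  assumes "t \<noteq> 0" "m > 0" "\<bar>t\<bar> * int m \<le> int n"
  shows "t \<in> multipliers n m"
proof -
  have "\<bar>t\<bar> \<le> int n div int m"
    using zdiv_mono1[OF assms(3), of "int m"] assms(2) by simp
  then show ?thesis
    using assms(1) by (auto simp: multipliers_def zdiv_int)
qed

text \<open>The dominant coordinate is put first and made positive, its sign going into
  \<open>t\<close>; swapping covers the other case. Non-primitive pairs \<open>(a, b)\<close> are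
  included, which is harmless for an upper bound.\<close>

definition short_vectors :: "nat \<Rightarrow> nat \<Rightarrow> (int \<times> int) set" where
  "short_vectors n M = (\<Union>a\<in>{1..M}.
     (\<lambda>(b, t). (t * int a, t * b)) ` ({- int a..int a} \<times> multipliers n a))"

lemma finite_short_vectors [simp]: "finite (short_vectors n M)"
  by (simp add: short_vectors_def)

text \<open>For fixed \<open>a\<close> there are at most \<open>3 * a\<close> values of
  \<open>b\<close> and \<open>2 * (n div a)\<close> multipliers, so \<open>a\<close> cancels and
  each \<open>a\<close> costs at most \<open>6 * n\<close>.\<close>

lemma card_short_vectors: "card (short_vectors n M) \<le> 6 * n * M"
proof -
  have "card ((\<lambda>(b, t). (t * int a, t * b)) ` ({- int a..int a} \<times> multipliers n a)) \<le> 6 * n"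
    if "a \<in> {1..M}" for a
  proof -
    have "card ((\<lambda>(b, t). (t * int a, t * b)) ` ({- int a..int a} \<times> multipliers n a))
        \<le> card ({- int a..int a} \<times> multipliers n a)"
      by (intro card_image_le) simp
    also have "\<dots> = (2 * a + 1) * (2 * (n div a))"
      by (simp add: card_cartesian_product card_multipliers nat_add_distrib nat_mult_distrib)
    also have "\<dots> \<le> (3 * a) * (2 * (n div a))"
      using that by (intro mult_right_mono) auto
    also have "\<dots> = 6 * (n div a * a)" by simp
    also have "\<dots> \<le> 6 * n"
      by (intro mult_left_mono div_times_less_eq_dividend) simp
    finally show ?thesis .
  qed
  then have "card (short_vectors n M) \<le> card {1..M} * (6 * n)"
    unfolding short_vectors_def
    by (intro order_trans[OF card_UN_le] order_trans[OF sum_bounded_above]) auto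
  then show ?thesis by (simp add: mult.commute)
qed

lemma in_short_vectorsI:
  assumes "t \<noteq> 0" "a \<noteq> 0" "\<bar>b\<bar> \<le> \<bar>a\<bar>" "\<bar>a\<bar> \<le> int M" "\<bar>t * a\<bar> \<le> int n"
  shows "(t * a, t * b) \<in> short_vectors n M"
proof -
  have "t * sgn a \<in> multipliers n (nat \<bar>a\<bar>)"
    using assms by (intro in_multipliersI) (auto simp: abs_mult sgn_if)
  moreover have "(t * a, t * b) =
      ((t * sgn a) * int (nat \<bar>a\<bar>), (t * sgn a) * (sgn a * b))"
    using assms(2) by (auto simp: sgn_if)
  moreover have "sgn a * b \<in> {- int (nat \<bar>a\<bar>)..int (nat \<bar>a\<bar>)}"
    using assms(3) by (auto simp: sgn_if)
  moreover have "nat \<bar>a\<bar> \<in> {1..M}"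
    using assms(2,4) by auto
  ultimately show ?thesis
    unfolding short_vectors_def
    by (intro UN_I[of "nat \<bar>a\<bar>"] image_eqI[of _ _ "(sgn a * b, t * sgn a)"]) simp_all
qed

section \<open>Primitive directions and lines with few grid points\<close>

definition direction :: "int \<times> int \<Rightarrow> int \<times> int" where
  "direction w = (fst w div gcd (fst w) (snd w), snd w div gcd (fst w) (snd w))"

definition max_norm :: "int \<times> int \<Rightarrow> nat" where
  "max_norm w = nat (max \<bar>fst w\<bar> \<bar>snd w\<bar>)"

lemma parallel_imp_multiple_of_direction:
  assumes "w \<noteq> 0" and "fst v * snd w = snd v * fst w"
  obtains t where "fst v = t * fst (direction w)" "snd v = t * snd (direction w)"
proof -
  obtain p q where w: "w = (p, q)" by (cases w)
  obtain u u' where v: "v = (u, u')" by (cases v)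
  define g where "g = gcd p q"
  have "g \<noteq> 0" using assms(1) w by (auto simp: g_def zero_prod_def)
  define a where "a = p div g"
  define b where "b = q div g"
  have ab: "p = a * g" "q = b * g" by (simp_all add: a_def b_def g_def)
  have "coprime a b"
    using \<open>g \<noteq> 0\<close> unfolding a_def b_def g_def by (intro div_gcd_coprime) auto
  then obtain r s where rs: "r * a + s * b = 1"
    using bezout_int[of a b] by auto
  have par: "u * b = u' * a"
    using assms(2) \<open>g \<noteq> 0\<close> by (simp add: w v ab)
  \<comment> \<open>Multiply \<open>r * a + s * b = 1\<close> by \<open>u\<close> and by
    \<open>u'\<close>, then trade \<open>u * b\<close> for \<open>u' * a\<close>.\<close>
  have "u = (r * u + s * u') * a" "u' = (r * u + s * u') * b"
    using rs par by algebra+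
  then show thesis
    by (intro that[of "r * u + s * u'"]) (simp_all add: direction_def w v a_def b_def g_def)
qed

text \<open>Short directions give the empty set because \<open>short_vectors\<close> and its swap
  account for them; this also disposes of \<open>w = 0\<close>, whose direction is
  \<open>(0, 0)\<close>.\<close>

definition sparse_line :: "nat \<Rightarrow> nat \<Rightarrow> int \<times> int \<Rightarrow> (int \<times> int) set" where
  "sparse_line n M w =
     (if max_norm (direction w) \<le> M then {}
      else (\<lambda>t. (t * fst (direction w), t * snd (direction w))) `
             multipliers n (max_norm (direction w)))"

lemma finite_sparse_line [simp]: "finite (sparse_line n M w)"
  by (simp add: sparse_line_def)

lemma card_sparse_line:
  assumes "M > 0"
  shows "card (sparse_line n M w) \<le> 2 * (n div M)"
proof (cases "max_norm (direction w) \<le> M")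
  case False
  let ?m = "max_norm (direction w)"
  have "card (sparse_line n M w) \<le> card (multipliers n ?m)"
    using False by (simp add: sparse_line_def card_image_le)
  also have "\<dots> \<le> 2 * (n div M)"
    using False assms by (simp add: card_multipliers div_le_mono2)
  finally show ?thesis .
qed (simp add: sparse_line_def)

text \<open>The first two sets do not depend on \<open>w\<close>, so short directions are paid for
  once per base point; only long directions are paid for line by line.\<close>

lemma parallel_cases:
  assumes "w \<noteq> 0" "v \<noteq> 0" "fst v * snd w = snd v * fst w" "max_norm v \<le> n"
  shows "v \<in> short_vectors n M \<union> prod.swap ` short_vectors n M \<union> sparse_line n M w"
proof -
  obtain t where t: "fst v = t * fst (direction w)" "snd v = t * snd (direction w)"
    using parallel_imp_multiple_of_direction[OF assms(1,3)] by metis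
  obtain a b where ab: "direction w = (a, b)" by (cases "direction w")
  have v: "v = (t * a, t * b)" using t ab by (simp add: prod_eq_iff)
  have "t \<noteq> 0" and nz: "a \<noteq> 0 \<or> b \<noteq> 0"
    using assms(2) v by (auto simp: zero_prod_def)
  have bound: "\<bar>t * a\<bar> \<le> int n" "\<bar>t * b\<bar> \<le> int n"
    using assms(4) v by (auto simp: max_norm_def)
  consider "\<bar>b\<bar> \<le> \<bar>a\<bar>" "\<bar>a\<bar> \<le> int M" | "\<bar>a\<bar> \<le> \<bar>b\<bar>" "\<bar>b\<bar> \<le> int M"
    | "max_norm (direction w) > M"
    unfolding max_norm_def ab by fastforce
  then show ?thesis
  proof cases
    case 1
    then have "v \<in> short_vectors n M"
      unfolding v using \<open>t \<noteq> 0\<close> nz bound by (intro in_short_vectorsI) auto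
    then show ?thesis by blast
  next
    case 2
    then have "(t * b, t * a) \<in> short_vectors n M"
      using \<open>t \<noteq> 0\<close> nz bound by (intro in_short_vectorsI) auto
    then have "prod.swap (t * b, t * a) \<in> prod.swap ` short_vectors n M"
      by (rule imageI)
    then show ?thesis by (simp add: v)
  next
    case 3
    \<comment> \<open>The norm is attained at one of the two coordinates, and both satisfy
      \<open>bound\<close>.\<close>
    have "\<bar>t\<bar> * int (max_norm (a, b)) \<le> int n"
      using bound by (auto simp: max_norm_def abs_mult max_def)
    then have "t \<in> multipliers n (max_norm (direction w))"
      using \<open>t \<noteq> 0\<close> 3 by (intro in_multipliersI) (auto simp: ab)
    then have "v \<in> sparse_line n M w"
      using 3 by (auto simp: sparse_line_def v ab)
    then show ?thesis by blast
  qed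
qed

section \<open>Covering the integer grid\<close>

text \<open>Collinearity is written as a vanishing cross product. The set \<open>V x\<close>
  contains the displacements from \<open>x\<close> to all grid points on lines joining
  \<open>x\<close> to other points of \<open>P\<close>, so the translates of the \<open>V x\<close>
  cover all \<open>n * n\<close> points.\<close>

lemma integer_domination_bound:
  fixes P :: "(int \<times> int) set"
  assumes P: "P \<subseteq> {1..int n} \<times> {1..int n}"
    and dom: "\<And>p. p \<in> {1..int n} \<times> {1..int n} \<Longrightarrow> p \<in> P \<or>
      (\<exists>x\<in>P. \<exists>y\<in>P. x \<noteq> y \<and> fst (p - x) * snd (y - x) = snd (p - x) * fst (y - x))"
    and "n \<ge> 1" and M: "M \<ge> 1" "card P \<le> M\<^sup>2"
  shows "n \<le> 15 * card P * M"
proof -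
  have "finite P" using P by (rule finite_subset) simp
  \<comment> \<open>The zero displacement accounts for the points of \<open>P\<close>
    themselves.\<close>
  define V where "V x = {0} \<union> (short_vectors n M \<union> prod.swap ` short_vectors n M) \<union>
      (\<Union>y\<in>P. sparse_line n M (y - x))" for x
  have card_V: "card (V x) \<le> 15 * n * M" for x
  proof -
    have "card (\<Union>y\<in>P. sparse_line n M (y - x)) \<le> card P * (2 * (n div M))"
      using card_sparse_line[of M n] M(1) \<open>finite P\<close>
        sum_bounded_above[of P "\<lambda>y. card (sparse_line n M (y - x))" "2 * (n div M)"]
      by (intro order_trans[OF card_UN_le]) simp_all
    \<comment> \<open>The choice of \<open>M\<close> balances the two counts: at most
      \<open>M\<^sup>2\<close> long lines with \<open>2 * (n div M)\<close> vectors each again give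
      order \<open>n * M\<close>.\<close>
    also have "\<dots> \<le> M\<^sup>2 * (2 * (n div M))"
      using M(2) by (rule mult_right_mono) simp
    also have "\<dots> = 2 * (n div M * M) * M" by (simp add: power2_eq_square)
    also have "\<dots> \<le> 2 * n * M"
      by (intro mult_right_mono mult_left_mono div_times_less_eq_dividend) auto
    finally have lines: "card (\<Union>y\<in>P. sparse_line n M (y - x)) \<le> 2 * n * M" .
    have "card (prod.swap ` short_vectors n M) \<le> 6 * n * M"
      using card_image_le[of "short_vectors n M" prod.swap] card_short_vectors[of n M] by simp
    then have short: "card (short_vectors n M \<union> prod.swap ` short_vectors n M) \<le> 12 * n * M"
      using card_Un_le[of "short_vectors n M" "prod.swap ` short_vectors n M"]
        card_short_vectors[of n M] by simp
    have "card (V x) \<le> card {0 :: int \<times> int} +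
        card (short_vectors n M \<union> prod.swap ` short_vectors n M) +
        card (\<Union>y\<in>P. sparse_line n M (y - x))"
      unfolding V_def by (intro order_trans[OF card_Un_le] add_right_mono card_Un_le)
    moreover have "card {0 :: int \<times> int} = 1" by simp
    \<comment> \<open>This absorbs the zero vector: 15 = 1 + 12 + 2.\<close>
    moreover have "1 \<le> n * M" using \<open>n \<ge> 1\<close> M(1) by simp
    ultimately show ?thesis using lines short by linarith
  qed
  have fin_V: "finite (V x)" for x
    using \<open>finite P\<close> by (simp add: V_def)
  have "p \<in> (\<Union>x\<in>P. (+) x ` V x)" if p: "p \<in> {1..int n} \<times> {1..int n}" for p
  proof (cases "p \<in> P")
    case True
    then show ?thesis by (force simp: V_def)
  next
    case False
    then obtain x y where xy: "x \<in> P" "y \<in> P" "x \<noteq> y"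
        "fst (p - x) * snd (y - x) = snd (p - x) * fst (y - x)"
      using dom[OF p] by blast
    have "x \<in> {1..int n} \<times> {1..int n}" using P xy(1) by blast
    then have "max_norm (p - x) \<le> n"
      using p by (auto simp: max_norm_def)
    then have "p - x \<in> V x"
      using parallel_cases[of "y - x" "p - x" n M] xy False by (auto simp: V_def)
    then have "x + (p - x) \<in> (+) x ` V x" by (rule imageI)
    then show ?thesis using xy(1) by auto
  qed
  then have "{1..int n} \<times> {1..int n} \<subseteq> (\<Union>x\<in>P. (+) x ` V x)" by blast
  then have "card ({1..int n} \<times> {1..int n}) \<le> card (\<Union>x\<in>P. (+) x ` V x)"
    using \<open>finite P\<close> fin_V by (intro card_mono) auto
  also have "\<dots> \<le> (\<Sum>x\<in>P. card ((+) x ` V x))"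
    using \<open>finite P\<close> by (rule card_UN_le)
  also have "\<dots> \<le> card P * (15 * n * M)"
    using sum_bounded_above[of P "\<lambda>x. card ((+) x ` V x)" "15 * n * M"]
      order_trans[OF card_image_le[OF fin_V] card_V] by (metis of_nat_id)
  finally have "n * n \<le> (15 * card P * M) * n"
    by (simp add: card_cartesian_product algebra_simps)
  then show ?thesis using \<open>n \<ge> 1\<close> by simp
qed

section \<open>Back to the real grid and the exponent\<close>

lemma dominating_set_bound:
  assumes S: "dominating_set n S" and "n \<ge> 1" and M: "M \<ge> 1" "card S \<le> M\<^sup>2"
  shows "n \<le> 15 * card S * M"
proof -
  define \<phi> :: "int \<times> int \<Rightarrow> real \<times> real" where "\<phi> = map_prod of_int of_int"
  have inj: "inj \<phi>" unfolding \<phi>_def by (intro prod.inj_map) (auto simp: inj_def)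
  have grid: "grid n = \<phi> ` ({1..int n} \<times> {1..int n})"
  proof -
    have "{1..int n} = int ` {1..n}" by (simp add: image_int_atLeastAtMost)
    then show ?thesis
      by (force simp: grid_def \<phi>_def image_iff)
  qed
  define P where "P = \<phi> -` S"
  have sub: "S \<subseteq> \<phi> ` ({1..int n} \<times> {1..int n})"
    using S by (simp add: dominating_set_def grid)
  have card: "card P = card S"
    unfolding P_def using inj sub by (intro card_vimage_inj) auto
  have "n \<le> 15 * card P * M"
  proof (rule integer_domination_bound)
    show "P \<subseteq> {1..int n} \<times> {1..int n}"
      using sub inj unfolding P_def by (blast dest: injD)
  next
    fix p assume "p \<in> {1..int n} \<times> {1..int n}"
    then have "dominated S (\<phi> p)"
      using S by (auto simp: dominating_set_def grid)
    then consider "\<phi> p \<in> S"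
      | X Y where "X \<in> S" "Y \<in> S" "X \<noteq> Y" "collinear {X, Y, \<phi> p}"
      unfolding dominated_def by blast
    then show "p \<in> P \<or> (\<exists>x\<in>P. \<exists>y\<in>P. x \<noteq> y \<and>
        fst (p - x) * snd (y - x) = snd (p - x) * fst (y - x))"
    proof cases
      case 1
      then show ?thesis by (simp add: P_def)
    next
      case 2
      obtain x y where xy: "X = \<phi> x" "Y = \<phi> y" using 2 sub by blast
      \<comment> \<open>Both differences are multiples of one vector \<open>u\<close>, so their
        cross product vanishes; injectivity of \<open>of_int\<close> then moves the identity to the
        integers.\<close>
      obtain u c d where u: "Y - X = c *\<^sub>R u" "\<phi> p - X = d *\<^sub>R u"
        using 2(4) unfolding collinear_def by blast
      have "fst (\<phi> p - X) * snd (Y - X) = snd (\<phi> p - X) * fst (Y - X)"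
        unfolding u by simp
      then have "real_of_int (fst (p - x) * snd (y - x)) = real_of_int (snd (p - x) * fst (y - x))"
        by (simp add: xy \<phi>_def)
      then have "fst (p - x) * snd (y - x) = snd (p - x) * fst (y - x)"
        by (simp only: of_int_eq_iff)
      moreover have "x \<in> P" "y \<in> P" "x \<noteq> y" using 2 xy by (auto simp: P_def)
      ultimately show ?thesis by blast
    qed
  qed (use assms card in auto)
  then show ?thesis by (simp add: card)
qed

theorem theorem3:
  shows "\<exists>c::real. c > 0 \<and>
    (\<forall>n::nat. n \<ge> 1 \<longrightarrow> real (domination_number n) \<ge> c * real n powr (2 / 3))"
proof (intro exI[of _ "(1 / 30) powr (2 / 3)"] conjI allI impI)
  fix n :: nat assume n: "n \<ge> 1"
  define k where "k = domination_number n"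
  obtain S where S: "dominating_set n S" "card S = k"
    using domination_number_attained unfolding k_def by blast
  \<comment> \<open>For \<open>k = 0\<close> the bound with \<open>M = 1\<close> would read
    \<open>n \<le> 0\<close>.\<close>
  have "k \<noteq> 0"
    using dominating_set_bound[OF S(1) n, of 1] S(2) n by (cases "k = 0") auto
  define M where "M = nat \<lceil>sqrt (real k)\<rceil>"
  have "sqrt (real k) \<le> real M" unfolding M_def by linarith
  then have "real k \<le> (real M)\<^sup>2"
    by (rule sqrt_le_D)
  then have kM: "k \<le> M\<^sup>2" by (metis of_nat_le_iff of_nat_power)
  then have "M \<ge> 1" using \<open>k \<noteq> 0\<close> by (cases M) auto
  \<comment> \<open>Rounding up adds less than 1, hence at most another
    \<open>sqrt (real k)\<close>.\<close>
  have "1 \<le> sqrt (real k)" using \<open>k \<noteq> 0\<close> by simp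
  then have M2: "real M \<le> 2 * sqrt (real k)" unfolding M_def by linarith
  have "n \<le> 15 * k * M"
    using dominating_set_bound[OF S(1) n \<open>M \<ge> 1\<close>] S(2) kM by simp
  then have "real n \<le> 15 * real k * real M"
    by (metis of_nat_le_iff of_nat_mult of_nat_numeral)
  also have "\<dots> \<le> 15 * real k * (2 * sqrt (real k))"
    using M2 by (intro mult_left_mono) auto
  also have "\<dots> = 30 * real k powr (3 / 2)"
    using powr_add[of "real k" 1 "1 / 2"] \<open>k \<noteq> 0\<close> by (simp add: powr_half_sqrt)
  finally have "1 / 30 * real n \<le> real k powr (3 / 2)" by simp
  \<comment> \<open>The 30 is 15 from the grid count times 2 from rounding; the power 2/3 inverts
    3/2.\<close>
  then have "(1 / 30 * real n) powr (2 / 3) \<le> (real k powr (3 / 2)) powr (2 / 3)"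
    by (intro powr_mono2) auto
  also have "\<dots> = real k"
    using \<open>k \<noteq> 0\<close> by (simp add: powr_powr)
  finally show "(1 / 30) powr (2 / 3) * real n powr (2 / 3) \<le> real (domination_number n)"
    by (simp only: powr_mult k_def)
qed simp

end
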